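(* Let $p$ be an odd prime. For all integers $1\le n\le 2p-2$ and all integers $m\ge0$, $$N(m,n)\le F(n),$$ where $F(n)$ is the $n$-th number in the Fibonacci sequence.
   Context: For $m,n\in\mathbb N=\{0,1,2,\dots\}$ and $r\ge1$, $N_r(m,n)$ is the number of pairs $(\mathfrak a,\mathfrak b)$, $\mathfrak a=(a_1,\dots,a_r)\in\mathbb N^r$, $\mathfrak b=(b_1,\dots,b_r)\in\{0,1\}^r$, satisfying $2\sum_{i=1}^r a_i+\sum_{j=1}^r b_j=n$ and $b_1+\sum_{i=1}^{r-1}(a_i+b_{i+1})p^i+a_rp^r=m$. This number does not depend on $r$ once $p^r>m$, and $N(m,n)$ denotes this stable value. Fibonacci numbers: $F(1)=F(2)=1$ and $F(n)=F(n-1)+F(n-2)$ for $n\ge3$. *)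

theory Defs
  imports "HOL-Computational_Algebra.Primes" "HOL-Number_Theory.Fib" "HOL-Library.FuncSet"
begin

text \<open>Tuples indexed by \<open>1, \<dots>, r\<close> are represented as extensional functions on \<open>{1..r}\<close>,
  so that each tuple corresponds to exactly one function and cardinalities are correct.\<close>

definition solutions :: "nat \<Rightarrow> nat \<Rightarrow> nat \<Rightarrow> nat \<Rightarrow> ((nat \<Rightarrow> nat) \<times> (nat \<Rightarrow> nat)) set" where
  "solutions p r m n =
    {(a, b). a \<in> {1..r} \<rightarrow>\<^sub>E UNIV \<and> b \<in> {1..r} \<rightarrow>\<^sub>E {0, 1} \<and>
      2 * (\<Sum>i=1..r. a i) + (\<Sum>j=1..r. b j) = n \<and>
      b 1 + (\<Sum>i=1..<r. (a i + b (i + 1)) * p ^ i) + a r * p ^ r = m}"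

definition N_level :: "nat \<Rightarrow> nat \<Rightarrow> nat \<Rightarrow> nat \<Rightarrow> nat" where
  "N_level p r m n = card (solutions p r m n)"

text \<open>The stable value; \<open>N_stable_eq\<close> below shows that the description is proper for \<open>p > 1\<close>.\<close>

definition N_stable :: "nat \<Rightarrow> nat \<Rightarrow> nat \<Rightarrow> nat" where
  "N_stable p m n = (THE v. \<forall>r\<ge>1. p ^ r > m \<longrightarrow> N_level p r m n = v)"

lemma finite_solutions: "finite (solutions p r m n)"
proof (rule finite_subset)
  show "solutions p r m n \<subseteq> ({1..r} \<rightarrow>\<^sub>E {0..n}) \<times> ({1..r} \<rightarrow>\<^sub>E {0, 1})"
  proof (clarsimp simp: solutions_def)
    fix a b :: "nat \<Rightarrow> nat"
    assume a: "a \<in> {Suc 0..r} \<rightarrow>\<^sub>E UNIV"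
    show "a \<in> {Suc 0..r} \<rightarrow>\<^sub>E {0..2 * sum a {Suc 0..r} + sum b {Suc 0..r}}"
    proof (rule PiE_I)
      fix i assume i: "i \<in> {Suc 0..r}"
      have "a i \<le> sum a {Suc 0..r}"
        using i by (intro member_le_sum) auto
      then show "a i \<in> {0..2 * sum a {Suc 0..r} + sum b {Suc 0..r}}" by simp
    qed (use a in \<open>auto simp: PiE_def extensional_def\<close>)
  qed
  show "finite (({1..r} \<rightarrow>\<^sub>E {0..n}) \<times> ({1..r} \<rightarrow>\<^sub>E {0, 1::nat}))"
    by (intro finite_cartesian_product finite_PiE) auto
qed

lemma N_level_Suc:
  assumes r: "r \<ge> 1" and pr: "p ^ r > m"
  shows "N_level p (Suc r) m n = N_level p r m n"
proof -
  let ?ext = "\<lambda>(a, b). (a(Suc r := 0), b(Suc r := 0)) :: (nat \<Rightarrow> nat) \<times> (nat \<Rightarrow> nat)"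
  let ?res = "\<lambda>(a, b). (restrict a {1..r}, restrict b {1..r}) :: (nat \<Rightarrow> nat) \<times> (nat \<Rightarrow> nat)"
  have p0: "p > 0" using r pr by (cases "p = 0") (auto simp: power_0_left)
  have small: "x = 0" if "x * p ^ r + y = m" for x y
    using that pr by (cases x) auto
  have small': "x = 0" if "x * p ^ Suc r + y = m" for x y
    using small[of "x * p" y] that p0 by (auto simp: mult_ac)
  have top: "a r = 0 \<and> b (Suc r) = 0 \<and> a (Suc r) = 0" if "(a, b) \<in> solutions p (Suc r) m n" for a b
  proof -
    have eq: "b 1 + (\<Sum>i=1..<r. (a i + b (i + 1)) * p ^ i) + (a r + b (Suc r)) * p ^ r
        + a (Suc r) * p ^ Suc r = m"
      using that r by (auto simp: solutions_def)
    have "a r + b (Suc r) = 0"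
      by (rule small[of _ "b 1 + (\<Sum>i=1..<r. (a i + b (i + 1)) * p ^ i) + a (Suc r) * p ^ Suc r"])
        (use eq in linarith)
    moreover have "a (Suc r) = 0"
      by (rule small'[of _ "b 1 + (\<Sum>i=1..<r. (a i + b (i + 1)) * p ^ i) + (a r + b (Suc r)) * p ^ r"])
        (use eq in linarith)
    ultimately show ?thesis by simp
  qed
  have top': "a r = 0" if "(a, b) \<in> solutions p r m n" for a b
  proof -
    have "b 1 + (\<Sum>i=1..<r. (a i + b (i + 1)) * p ^ i) + a r * p ^ r = m"
      using that by (auto simp: solutions_def)
    then show ?thesis
      by (intro small[of _ "b 1 + (\<Sum>i=1..<r. (a i + b (i + 1)) * p ^ i)"]) linarith
  qed
  have "bij_betw ?ext (solutions p r m n) (solutions p (Suc r) m n)"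
  proof (rule bij_betw_byWitness[where f' = ?res])
    show "\<forall>x\<in>solutions p r m n. ?res (?ext x) = x"
      by (auto simp: solutions_def PiE_def extensional_def restrict_def fun_eq_iff)
    show "\<forall>x\<in>solutions p (Suc r) m n. ?ext (?res x) = x"
      using top by (fastforce simp: solutions_def PiE_def extensional_def restrict_def fun_eq_iff)
    show "?ext ` solutions p r m n \<subseteq> solutions p (Suc r) m n"
    proof clarify
      fix a b assume ab: "(a, b) \<in> solutions p r m n"
      have s: "(\<Sum>i=1..<r. ((a(Suc r := 0)) i + (b(Suc r := 0)) (i + 1)) * p ^ i)
          = (\<Sum>i=1..<r. (a i + b (i + 1)) * p ^ i)"
        by (intro sum.cong) auto
      have t: "(\<Sum>i=1..r. (a(Suc r := 0)) i) = (\<Sum>i=1..r. a i)"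
        "(\<Sum>i=1..r. (b(Suc r := 0)) i) = (\<Sum>i=1..r. b i)"
        by (auto intro!: sum.cong)
      have "a(Suc r := 0) \<in> {1..Suc r} \<rightarrow>\<^sub>E UNIV" "b(Suc r := 0) \<in> {1..Suc r} \<rightarrow>\<^sub>E {0, 1}"
        using ab by (auto simp: solutions_def PiE_def extensional_def Pi_def)
      then show "(a(Suc r := 0), b(Suc r := 0)) \<in> solutions p (Suc r) m n"
        using ab top'[OF ab] r s t unfolding solutions_def by simp
    qed
    show "?res ` solutions p (Suc r) m n \<subseteq> solutions p r m n"
    proof clarify
      fix a b assume ab: "(a, b) \<in> solutions p (Suc r) m n"
      have s: "(\<Sum>i=1..<r. (restrict a {1..r} i + restrict b {1..r} (i + 1)) * p ^ i)
          = (\<Sum>i=1..<r. (a i + b (i + 1)) * p ^ i)"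
        by (intro sum.cong) auto
      have t: "(\<Sum>i=1..r. restrict a {1..r} i) = (\<Sum>i=1..r. a i)"
        "(\<Sum>i=1..r. restrict b {1..r} i) = (\<Sum>i=1..r. b i)"
        by (auto intro!: sum.cong)
      have "restrict a {1..r} \<in> {1..r} \<rightarrow>\<^sub>E UNIV" "restrict b {1..r} \<in> {1..r} \<rightarrow>\<^sub>E {0, 1}"
        using ab by (auto simp: solutions_def PiE_def Pi_def)
      then show "(restrict a {1..r}, restrict b {1..r}) \<in> solutions p r m n"
        using ab top[OF ab] r s t unfolding solutions_def by simp
    qed
  qed
  then show ?thesis unfolding N_level_def by (simp add: bij_betw_same_card)
qed

lemma N_level_stable:
  assumes "p > 1" "r \<ge> 1" "p ^ r > m" "s \<ge> r"
  shows "N_level p s m n = N_level p r m n"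
  using assms(4)
proof (induction s rule: dec_induct)
  case (step s)
  have "p ^ r \<le> p ^ s" using assms(1) step.hyps by (intro power_increasing) auto
  then have "p ^ s > m" using assms(3) by linarith
  then have "N_level p (Suc s) m n = N_level p s m n"
    using assms(2) step.hyps by (intro N_level_Suc) auto
  then show ?case using step.IH by simp
qed simp

lemma N_stable_eq:
  assumes "p > 1" "r \<ge> 1" "p ^ r > m"
  shows "N_stable p m n = N_level p r m n"
  unfolding N_stable_def
proof (rule the_equality)
  show "\<forall>s\<ge>1. p ^ s > m \<longrightarrow> N_level p s m n = N_level p r m n"
    using N_level_stable[OF assms(1)] assms by (metis nle_le)
qed (use assms in blast)

end

theory Submission imports Defs begin

text \<open>Put \<open>c\<^sub>0 = b\<^sub>1\<close>, \<open>c\<^sub>i = a\<^sub>i + b\<^sub>i\<^sub>+\<^sub>1\<close> for \<open>1 \<le> i < r\<close> and \<open>c\<^sub>r = a\<^sub>r\<close>, so that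
  \<open>\<Sum> c\<^sub>i p\<^sup>i = m\<close>. If \<open>c\<^sub>i \<ge> p\<close> for some \<open>i \<ge> 1\<close>, then \<open>2 a\<^sub>i + b\<^sub>i\<^sub>+\<^sub>1 \<ge> 2 p - 1 > n\<close>; hence the \<open>c\<^sub>i\<close>
  are the base-\<open>p\<close> digits of \<open>m\<close> and are the same for all solutions. A solution is then determined
  by the set \<open>{i. b\<^sub>i\<^sub>+\<^sub>1 = 1}\<close>, a subset of the at most \<open>s = c\<^sub>1 + \<dots> + c\<^sub>r\<close> indices with \<open>c\<^sub>i \<noteq> 0\<close>,
  of prescribed size \<open>2 s - (n - b\<^sub>1)\<close>. The number of such subsets is at most
  \<open>s choose (n - b\<^sub>1 - s)\<close>, which for \<open>s > 0\<close> is at most \<open>F(n - b\<^sub>1)\<close> by comparing the recurrences of Pascal and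
  Fibonacci.\<close>

text \<open>Pascal's rule splits the left side just as the Fibonacci recurrence splits the right.
  The case \<open>s = 0\<close> is excluded because \<open>0 choose 0 = 1\<close> exceeds
  \<open>fib 0 = 0\<close>.\<close>

lemma binomial_le_fib:
  assumes "0 < s"
  shows "s choose j \<le> fib (s + j)"
  using assms
proof (induction s arbitrary: j rule: nat_induct_non_zero)
  case 1
  show ?case by (cases j; cases "j - 1") (auto simp: binomial_eq_0)
next
  case (Suc s)
  show ?case
  proof (cases j)
    case 0
    then show ?thesis using fib_neq_0_nat[of "Suc s"] by (simp del: fib.simps)
  next
    case (Suc i)
    then show ?thesis using Suc.IH[of i] Suc.IH[of "Suc i"] by simp
  qed
qed

text \<open>Reduction modulo \<open>p\<close> isolates the lowest digit; cancelling it and dividing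
  by \<open>p\<close> leaves a shorter expansion for the induction.\<close>

lemma base_digits_unique:
  fixes c d :: "nat \<Rightarrow> nat"
  assumes "\<And>i. i < k \<Longrightarrow> c i < p" "\<And>i. i < k \<Longrightarrow> d i < p"
    and "(\<Sum>i<k. c i * p ^ i) = (\<Sum>i<k. d i * p ^ i)" and "i < k"
  shows "c i = d i"
  using assms
proof (induction k arbitrary: c d i)
  case (Suc k)
  have shift: "(\<Sum>i<Suc k. f i * p ^ i) = f 0 + p * (\<Sum>i<k. f (Suc i) * p ^ i)" for f :: "nat \<Rightarrow> nat"
    by (simp add: sum.lessThan_Suc_shift sum_distrib_left mult_ac del: sum.lessThan_Suc)
  have eq: "c 0 + p * (\<Sum>i<k. c (Suc i) * p ^ i) = d 0 + p * (\<Sum>i<k. d (Suc i) * p ^ i)"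
    using Suc.prems(3) unfolding shift .
  have lt: "c 0 < p" "d 0 < p" using Suc.prems by auto
  have c0: "c 0 = d 0" using arg_cong[OF eq, of "\<lambda>x. x mod p"] lt by simp
  have "(\<Sum>i<k. c (Suc i) * p ^ i) = (\<Sum>i<k. d (Suc i) * p ^ i)"
    using eq c0 lt by simp
  then have "c (Suc i) = d (Suc i)" if "i < k" for i
    using Suc.IH[of "\<lambda>i. c (Suc i)" "\<lambda>i. d (Suc i)" i] Suc.prems(1,2) that by simp
  then show ?case using c0 Suc.prems(4) by (cases i) auto
qed simp

definition digit :: "nat \<Rightarrow> (nat \<Rightarrow> nat) \<times> (nat \<Rightarrow> nat) \<Rightarrow> nat \<Rightarrow> nat" where
  "digit r = (\<lambda>(a, b) i. if i = 0 then b 1 else if i < r then a i + b (i + 1) else a r)"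

text \<open>Indices are shifted so that \<open>i\<close> names the digit to which
  \<open>b (i + 1)\<close> contributes. The entry \<open>b 1\<close> is left out, being digit 0
  itself.\<close>

definition support :: "nat \<Rightarrow> (nat \<Rightarrow> nat) \<times> (nat \<Rightarrow> nat) \<Rightarrow> nat set" where
  "support r = (\<lambda>(a, b). {i \<in> {1..<r}. b (i + 1) = 1})"

lemma solution_b_le_1:
  assumes "(a, b) \<in> solutions p r m n" "i \<in> {1..r}"
  shows "b i \<le> 1"
proof -
  have "b i \<in> {0, 1}" using assms by (auto simp: solutions_def PiE_def Pi_def)
  then show ?thesis by auto
qed

lemma digit_sum:
  assumes "x \<in> solutions p r m n" "r \<ge> 1"
  shows "(\<Sum>i<Suc r. digit r x i * p ^ i) = m"
proof -
  obtain a b where x: "x = (a, b)" by fastforce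
  have "{..<Suc r} = insert 0 (insert r {1..<r})" using assms(2) by auto
  moreover have "(\<Sum>i=1..<r. digit r x i * p ^ i) = (\<Sum>i=1..<r. (a i + b (i + 1)) * p ^ i)"
    by (intro sum.cong) (auto simp: x digit_def)
  ultimately show ?thesis using assms by (simp add: x digit_def solutions_def)
qed

lemma digit_less:
  assumes "x \<in> solutions p r m n" "r \<ge> 1" "n \<le> 2 * p - 2" "p > 1" "i < Suc r"
  shows "digit r x i < p"
proof -
  obtain a b where x: "x = (a, b)" by fastforce
  have n: "2 * (\<Sum>i=1..r. a i) + (\<Sum>j=1..r. b j) = n" using assms(1) by (simp add: x solutions_def)
  have a: "a j \<le> (\<Sum>i=1..r. a i)" and b: "b j \<le> (\<Sum>i=1..r. b i)" if "j \<in> {1..r}" for j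
    using that by (intro member_le_sum; simp)+
  consider "i = 0" | "0 < i" "i < r" | "i = r" "0 < i" using assms(5) by linarith
  then show ?thesis
  proof cases
    case 1
    then show ?thesis using solution_b_le_1[of a b p r m n 1] assms x by (simp add: digit_def)
  next
    case 2
    then have "2 * a i + b (i + 1) \<le> n" "b (i + 1) \<le> 1"
      using a[of i] b[of "i + 1"] n solution_b_le_1[of a b p r m n "i + 1"] assms(1) x by auto
    then show ?thesis using 2 assms(3,4) by (simp add: x digit_def)
  next
    case 3
    then show ?thesis using a[of r] n assms(3,4) by (simp add: x digit_def)
  qed
qed

text \<open>In \<open>n\<close> each \<open>a i\<close> has weight 2 and each
  \<open>b (i + 1)\<close> weight 1; adding the size of the support raises the latter to 2 as well.
  Hence \<open>n\<close> and the digits fix that size.\<close>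

lemma degree_eq:
  assumes "x \<in> solutions p r m n" "r \<ge> 1"
  shows "n + card (support r x) = digit r x 0 + 2 * (\<Sum>i=1..r. digit r x i)"
proof -
  obtain a b where x: "x = (a, b)" by fastforce
  have b1: "b (i + 1) = (if b (i + 1) = 1 then 1 else 0)" if "i \<in> {1..<r}" for i
    using solution_b_le_1[of a b p r m n "i + 1"] assms that x by auto
  have "(\<Sum>i=1..<r. b (i + 1)) = (\<Sum>i=1..<r. if b (i + 1) = 1 then 1 else 0)"
    using b1 by (intro sum.cong refl) blast
  also have "\<dots> = card (support r x)"
    by (simp add: x support_def flip: sum.inter_filter)
  finally have S: "(\<Sum>i=1..<r. b (i + 1)) = card (support r x)" .
  have B: "(\<Sum>j=1..r. b j) = b 1 + (\<Sum>i=1..<r. b (i + 1))"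
  proof -
    have "(\<Sum>j=1..r. b j) = b 1 + (\<Sum>j=Suc 1..r. b j)"
      using assms(2) by (rule sum.atLeast_Suc_atMost)
    also have "{Suc 1..r} = {Suc 1..<Suc r}" by (rule atLeastLessThanSuc_atLeastAtMost[symmetric])
    finally show ?thesis by (simp only: Suc_eq_plus1 sum.shift_bounds_nat_ivl)
  qed
  have split: "(\<Sum>j=1..r. f j) = (\<Sum>i=1..<r. f i) + f r" for f :: "nat \<Rightarrow> nat"
    using assms(2) by (simp add: sum.last_plus add.commute)
  have "(\<Sum>i=1..<r. digit r x i) = (\<Sum>i=1..<r. a i + b (i + 1))"
    by (intro sum.cong) (auto simp: x digit_def)
  then have "(\<Sum>i=1..r. digit r x i) = (\<Sum>i=1..r. a i) + (\<Sum>i=1..<r. b (i + 1))"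
    using assms(2) unfolding split by (simp add: sum.distrib x digit_def)
  moreover have "2 * (\<Sum>i=1..r. a i) + (\<Sum>j=1..r. b j) = n"
    using assms(1) by (simp add: x solutions_def)
  ultimately show ?thesis using B S by (simp add: x digit_def)
qed

text \<open>Digit 0 gives \<open>b 1\<close>, the support gives the other \<open>b i\<close>, and
  subtracting these from the digits recovers \<open>a\<close>.\<close>

lemma solution_eqI:
  assumes x: "x \<in> solutions p r m n" and y: "y \<in> solutions p r m n"
    and d: "\<And>i. i \<le> r \<Longrightarrow> digit r x i = digit r y i" and s: "support r x = support r y"
  shows "x = y"
proof -
  obtain a b a' b' where xy: "x = (a, b)" "y = (a', b')" by fastforce
  have b: "b i = b' i" if i: "i \<in> {1..r}" for i
  proof (cases "i = 1")
    case True
    then show ?thesis using d[of 0] by (simp add: xy digit_def)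
  next
    case False
    have "i - 1 \<in> support r x \<longleftrightarrow> i - 1 \<in> support r y" using s by simp
    then have "b i = 1 \<longleftrightarrow> b' i = 1" using i False by (auto simp: xy support_def)
    moreover have "b i \<le> 1" "b' i \<le> 1"
      using solution_b_le_1[OF _ i] x y unfolding xy by blast+
    ultimately show ?thesis by linarith
  qed
  have a: "a i = a' i" if "i \<in> {1..r}" for i
    using d[of i] b[of "i + 1"] that by (auto simp: xy digit_def split: if_splits)
  have "a \<in> {1..r} \<rightarrow>\<^sub>E UNIV" "a' \<in> {1..r} \<rightarrow>\<^sub>E UNIV" "b \<in> {1..r} \<rightarrow>\<^sub>E {0, 1}" "b' \<in> {1..r} \<rightarrow>\<^sub>E {0, 1}"
    using x y by (simp_all add: xy solutions_def)
  then have "a = a'" "b = b'"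
    using a b by (metis PiE_ext)+
  then show ?thesis by (simp add: xy)
qed

lemma N_level_le_fib:
  assumes p: "p > 1" and r: "r \<ge> 1" and n: "1 \<le> n" "n \<le> 2 * p - 2"
  shows "N_level p r m n \<le> fib n"
proof (cases "solutions p r m n = {}")
  case True
  then show ?thesis by (simp add: N_level_def)
next
  case False
  then obtain z where z: "z \<in> solutions p r m n" by blast
  \<comment> \<open>The solution \<open>z\<close> serves only as a reference: its digits and support
    size are shared by all solutions.\<close>
  define c where "c = digit r z"
  have c: "digit r x i = c i" if "x \<in> solutions p r m n" "i \<le> r" for x i
    unfolding c_def
  proof (rule base_digits_unique[where k = "Suc r" and p = p and i = i])
    show "(\<Sum>j<Suc r. digit r x j * p ^ j) = (\<Sum>j<Suc r. digit r z j * p ^ j)"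
      unfolding digit_sum[OF that(1) r] digit_sum[OF z r] ..
  qed (use that(2) digit_less[OF that(1) r n(2) p] digit_less[OF z r n(2) p] in simp_all)
  define s where "s = (\<Sum>i=1..r. c i)"
  define e where "e = card (support r z)"
  define T where "T = {i \<in> {1..<r}. c i \<noteq> 0}"
  have deg: "n + card (support r x) = c 0 + 2 * s" if "x \<in> solutions p r m n" for x
    using degree_eq[OF that r] c[OF that] by (simp add: s_def)
  have sub: "support r x \<subseteq> T" if "x \<in> solutions p r m n" for x
  proof
    fix i assume "i \<in> support r x"
    then show "i \<in> T" using c[OF that, of i] by (auto simp: support_def T_def digit_def)
  qed
  \<comment> \<open>Each index in \<open>T\<close> carries a digit of at least 1.\<close>
  have "card T = (\<Sum>i\<in>T. 1)" by simp
  also have "\<dots> \<le> (\<Sum>i\<in>T. c i)" by (intro sum_mono) (auto simp: T_def)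
  also have "\<dots> \<le> s" unfolding s_def by (intro sum_mono2) (auto simp: T_def)
  finally have T: "card T \<le> s" .
  have "finite T" by (simp add: T_def)
  then have e: "e \<le> s" using card_mono[OF _ sub[OF z]] T by (simp add: e_def)
  have inj: "inj_on (support r) (solutions p r m n)"
    by (intro inj_onI, rule solution_eqI) (simp_all add: c)
  have img: "support r ` solutions p r m n \<subseteq> {B. B \<subseteq> T \<and> card B = e}"
  proof clarify
    fix a b assume "(a, b) \<in> solutions p r m n"
    then show "support r (a, b) \<subseteq> T \<and> card (support r (a, b)) = e"
      using sub deg deg[OF z] by (fastforce simp: e_def)
  qed
  have "N_level p r m n \<le> card {B. B \<subseteq> T \<and> card B = e}"
    unfolding N_level_def using \<open>finite T\<close> inj img by (intro card_inj_on_le) auto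
  also have "\<dots> = card T choose e" using \<open>finite T\<close> by (rule n_subsets)
  also have "\<dots> \<le> s choose e" using T by (rule binomial_right_mono)
  \<comment> \<open>The reflection brings in \<open>n\<close>: by \<open>deg\<close>,
    \<open>s + (s - e) = n - c 0\<close>, which is at most \<open>n\<close>.\<close>
  also have "\<dots> = s choose (s - e)" using e by (rule binomial_symmetric)
  also have "\<dots> \<le> fib n"
  \<comment> \<open>For \<open>s = 0\<close> the binomial coefficient is 1, and \<open>fib n\<close>
    is positive since \<open>1 \<le> n\<close>.\<close>
  proof (cases "s = 0")
    case True
    then show ?thesis using fib_neq_0_nat[of n] n by simp
  next
    case False
    then have "s choose (s - e) \<le> fib (s + (s - e))" by (intro binomial_le_fib) simp
    also have "\<dots> \<le> fib n" using deg[OF z] e by (intro fib_mono) (simp add: e_def)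
    finally show ?thesis .
  qed
  finally show ?thesis .
qed

theorem proposition3p6:
  fixes p m n :: nat
  assumes "prime p" and "odd p"
    and "1 \<le> n" and "n \<le> 2 * p - 2"
  shows "N_stable p m n \<le> fib n"
proof -
  have p: "p > 1" using assms(1) by (rule prime_gt_1_nat)
  \<comment> \<open>The level \<open>Suc m\<close> is chosen since it is at least 1 even for
    \<open>m = 0\<close>.\<close>
  have "m < p ^ m" using p by (intro power_gt_expt) simp
  also have "\<dots> \<le> p ^ Suc m" using p by (intro power_increasing) auto
  finally have "N_stable p m n = N_level p (Suc m) m n" using p by (intro N_stable_eq) auto
  also have "\<dots> \<le> fib n" using p assms(3,4) by (intro N_level_le_fib) auto
  finally show ?thesis .
qed

end
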